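(* Let $H_n$ be a random histogram transform with bin widths in $[\underline h_{0,n},\overline h_{0,n}]$, where $\underline h_{0,n}$ and $\overline h_{0,n}$ are of the same order, i.e. $c_{0,n}\overline h_{0,n}\le\underline h_{0,n}\le c_{0,n}^{-1}\overline h_{0,n}$ with constants $c_{0,n}\in(0,1)$ bounded away from $0$. Assume that the support $\mathcal X$ of $\mathrm P$ satisfies $\mathcal X\subset B_r\subset\mathbb R^d$ and that the density $f$ of $\mathrm P$ satisfies $f\in C^{0,\alpha}(B_r)$, $\alpha\in(0,1]$, and $\|f\|_{L_\infty(\mu)}<\infty$. Then, choosing $$\underline h_{0,n}:=(\log n/n)^{\frac1{2\alpha+d}},$$ for all $n\ge1$ (for which the quantities below are defined), with probability $\nu_n=\mathrm P^n\otimes\mathrm P_H$ at least $1-\frac1n$, $$\|f_{\mathrm D,H_n}-f\|_{L_\infty(\mu)}\lesssim(\log n/n)^{\frac{\alpha}{2\alpha+d}},$$ where the $L_\infty(\mu)$-norm is taken over $x\in B^+_{r,\sqrt d\,\overline h_{0,n}}$.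
   Context: $\mu$ is Lebesgue measure on $\mathbb R^d$; $\mathrm P$ is a probability measure on $\mathbb R^d$ with support $\mathcal X$ and density $f$ with respect to $\mu$; $X_1,\dots,X_n$ are i.i.d. from $\mathrm P$ and $\mathrm D=\frac1n\sum_{i=1}^n\delta_{X_i}$. For $r>0$, $B_r=[-r,r]^d$, $B_r^c=\mathbb R^d\setminus B_r$, and for $\delta\in(0,r/2)$, $B^+_{r,\delta}=[\delta,r-\delta]^d$; only those $n$ with $\underline h_{0,n}>0$ and $\sqrt d\,\overline h_{0,n}<r/2$ are considered. $a_n\lesssim b_n$ means $a_n\le c\,b_n$ for all $n$ with a constant $c>0$ independent of $n$. $f\in C^{0,\alpha}(B_r)$ means that for some $c_L>0$, $|f(x)-f(x')|\le c_L\|x-x'\|^\alpha$ for all $x,x'\in B_r$. Histogram transform with bin widths in $[\underline h_0,\overline h_0]$: the random affine map $H(x)=R\,S\,x+b$, where $R$ is a uniformly distributed $d\times d$ rotation matrix ($R^\top=R^{-1}$, $\det R=1$), $S=\mathrm{diag}(s_1,\dots,s_d)$ with $\log s_i$ independent and uniform on $[\log(1/\overline h_0),\log(1/\underline h_0)]$, $b$ is uniform on $[0,1]^d$, and $R,S,b$ are independent of each other and of the data. Its law is $\mathrm P_H$. The bin widths are $h_i=1/s_i\in[\underline h_0,\overline h_0]$. Bin of $x$: $A_H(x)=\{x'\in\mathbb R^d:\lfloor H(x')\rfloor=\lfloor H(x)\rfloor\}$ (coordinatewise floor). $(A_j)_{j\in\mathcal I_H}$ is the partition of $B_r$ consisting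 of the nonempty intersections of the bins with $B_r$, and $A_0:=B_r^c$. For a probability measure $\mathrm Q$, $f_{\mathrm Q,H}(x)=\mathrm Q(A_j)/\mu(A_j)$ for $x\in A_j$, $j\in\mathcal I_H\cup\{0\}$ (value $0$ on $A_0$). The estimator is $f_{\mathrm D,H}$. *)

theory Defs
  imports "HOL-Probability.Probability"
begin

definition cube :: "real \<Rightarrow> (real ^ 'd) set"
  where "cube r = {x. \<forall>i. - r \<le> x $ i \<and> x $ i \<le> r}"

definition inner_cube :: "real \<Rightarrow> real \<Rightarrow> (real ^ 'd) set"
  where "inner_cube r \<delta> = {x. \<forall>i. \<delta> \<le> x $ i \<and> x $ i \<le> r - \<delta>}"

definition holder_on :: "real \<Rightarrow> 'a::real_normed_vector set \<Rightarrow> ('a \<Rightarrow> real) \<Rightarrow> bool"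
  where "holder_on \<alpha> B f \<longleftrightarrow>
    (\<exists>c>0. \<forall>x\<in>B. \<forall>x'\<in>B. \<bar>f x - f x'\<bar> \<le> c * norm (x - x') powr \<alpha>)"

definition measure_support :: "'a::topological_space measure \<Rightarrow> 'a set"
  where "measure_support M = {x. \<forall>U. open U \<and> x \<in> U \<longrightarrow> emeasure M U > 0}"

text \<open>The norm takes values in \<^typ>\<open>ennreal\<close>; restricting the norm to a subset \<open>B\<close> of the domain
  means using \<^term>\<open>restrict_space M B\<close>.\<close>

definition Linf_norm :: "'a measure \<Rightarrow> ('a \<Rightarrow> real) \<Rightarrow> ennreal"
  where "Linf_norm M g = esssup M (\<lambda>x. ennreal \<bar>g x\<bar>)"

text \<open>For \<open>a = b\<close> the uniform distribution on \<open>[a, b]\<close> is the point mass at \<open>a\<close>; without the case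
  distinction, \<^const>\<open>uniform_measure\<close> would be the zero measure.\<close>

definition uniform_interval :: "real \<Rightarrow> real \<Rightarrow> real measure"
  where "uniform_interval a b =
    (if a < b then uniform_measure lborel {a..b} else return borel a)"

text \<open>The uniform distribution on the rotation group is its normalised Haar measure: the unique Borel
  probability measure carried by the rotations that is invariant under multiplication with
  any fixed rotation. It is regarded as a measure on the space of all square matrices.\<close>

definition uniform_rotation :: "(real ^ 'd ^ 'd) measure \<Rightarrow> bool"
  where "uniform_rotation \<rho> \<longleftrightarrow>
    prob_space \<rho> \<and> sets \<rho> = sets borel \<and> (AE R in \<rho>. rotation_matrix R) \<and>
    (\<forall>Q. rotation_matrix Q \<longrightarrow> distr \<rho> borel (\<lambda>R. Q ** R) = \<rho>)"

definition diag_matrix :: "('d \<Rightarrow> real) \<Rightarrow> real ^ 'd ^ 'd"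
  where "diag_matrix s = (\<chi> i j. if i = j then s i else 0)"

text \<open>A histogram transform is encoded by its parameters \<open>(R, s, b)\<close>: the rotation, the diagonal of
  the stretching matrix, and the translation.\<close>

type_synonym 'd ht_params = "(real ^ 'd ^ 'd) \<times> ('d \<Rightarrow> real) \<times> (real ^ 'd)"

definition hist_transform :: "'d::finite ht_params \<Rightarrow> real ^ 'd \<Rightarrow> real ^ 'd"
  where "hist_transform = (\<lambda>(R, s, b) x. (R ** diag_matrix s) *v x + b)"

definition stretch_law :: "real \<Rightarrow> real \<Rightarrow> real measure"
  where "stretch_law hl hu = distr (uniform_interval (ln (1 / hu)) (ln (1 / hl))) borel exp"

text \<open>The law of the parameters; \<open>\<rho>\<close> is the law of the rotation, \<open>[hl, hu]\<close> the range of the bin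
  widths.\<close>

definition hist_transform_law :: 
    "(real ^ 'd ^ 'd) measure \<Rightarrow> real \<Rightarrow> real \<Rightarrow> ('d::finite) ht_params measure"
  where "hist_transform_law \<rho> hl hu =
    \<rho> \<Otimes>\<^sub>M ((\<Pi>\<^sub>M i\<in>UNIV. stretch_law hl hu) \<Otimes>\<^sub>M
      uniform_measure lborel {b. \<forall>i. 0 \<le> b $ i \<and> b $ i \<le> 1})"

definition bin :: "(real ^ 'd \<Rightarrow> real ^ 'd) \<Rightarrow> real ^ 'd \<Rightarrow> (real ^ 'd) set"
  where "bin H x = {x'. \<forall>i. \<lfloor>H x' $ i\<rfloor> = \<lfloor>H x $ i\<rfloor>}"

definition cells :: "real \<Rightarrow> (real ^ 'd \<Rightarrow> real ^ 'd) \<Rightarrow> (real ^ 'd) set set"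
  where "cells r H = {bin H x \<inter> cube r |x. bin H x \<inter> cube r \<noteq> {}}"

definition hist_density ::
    "real \<Rightarrow> (real ^ 'd) measure \<Rightarrow> (real ^ 'd \<Rightarrow> real ^ 'd) \<Rightarrow> real ^ 'd \<Rightarrow> real"
  where "hist_density r Q H x =
    (if x \<in> cube r then measure Q (bin H x \<inter> cube r) / measure lborel (bin H x \<inter> cube r) else 0)"

lemma partition_on_cells: "partition_on (cube r) (cells r H)"
  by (rule partition_onI) (auto simp: cells_def bin_def disjnt_def)

lemma hist_density_cell:
  assumes "A \<in> cells r H" "x \<in> A"
  shows "hist_density r Q H x = measure Q A / measure lborel A"
proof -
  obtain y where y: "A = bin H y \<inter> cube r"
    using assms(1) by (auto simp: cells_def)
  have "bin H x = bin H y"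
    using assms(2) unfolding y by (auto simp: bin_def)
  then show ?thesis
    using assms(2) by (simp add: y hist_density_def)
qed

text \<open>The empirical measure of the sample \<open>X 0, \<dots>, X (n - 1)\<close>, as the image of the uniform
  distribution on the indices.\<close>

definition empirical_measure :: "nat \<Rightarrow> (nat \<Rightarrow> 'a::topological_space) \<Rightarrow> 'a measure"
  where "empirical_measure n X = distr (uniform_count_measure {..<n}) borel X"

lemma measure_empirical_measure:
  assumes "n \<ge> 1" "A \<in> sets borel"
  shows "measure (empirical_measure n X) A = (\<Sum>i<n. indicator A (X i)) / real n"
proof -
  have X: "X \<in> uniform_count_measure {..<n} \<rightarrow>\<^sub>M borel"
    by (auto simp: measurable_def sets_uniform_count_measure space_uniform_count_measure)
  have "measure (empirical_measure n X) A =
      measure (uniform_count_measure {..<n}) (X -` A \<inter> {..<n})"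
    using assms(2) X
    by (simp add: empirical_measure_def measure_distr space_uniform_count_measure)
  also have "\<dots> = real (card (X -` A \<inter> {..<n})) / real n"
    by (subst measure_uniform_count_measure) auto
  also have "real (card (X -` A \<inter> {..<n})) = (\<Sum>i<n. indicator A (X i))"
    by (simp add: indicator_def sum.If_cases vimage_def Int_commute)
  finally show ?thesis .
qed

end

theory Submission
  imports Defs
begin

text \<open>
  Condition on the transform. By Fubini's theorem it is enough to show that, for almost every fixed
  transform, the sample is good with probability at least \<open>1 - 1/n\<close>. Conditionally the partition is
  deterministic, so no uniform law over a class of partitions is involved: a union bound over the
  finitely many bins that meet the inner cube suffices.

  A bin \<open>A\<close> that meets the inner cube has diameter at most \<open>\<surd>d hu\<close> (\<open>norm_diff_bin_le\<close>), hence lies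
  inside the cube (\<open>bin_subset_cube\<close>), and contains a ball of radius \<open>hl / 2\<close>, so that its volume \<open>V\<close>
  is at least \<open>\<kappa> hl\<^sup>d\<close> for a constant \<open>\<kappa>\<close> (\<open>measure_bin_ge\<close>). Since these bins are disjoint, there are at
  most of the order of \<open>1 / hl\<^sup>d\<close> of them (\<open>finite_disjoint_family_measure_ge\<close>), which is at most of
  order \<open>n\<close>.

  On \<open>A\<close> the Hoelder condition bounds the bias \<open>P(A)/V - f(x)\<close> by a multiple of \<open>hu\<^sup>\<alpha>\<close>, which has the
  order of \<open>q = hl\<^sup>\<alpha>\<close> because the extreme bin widths are comparable. The count of observations in \<open>A\<close>
  is binomial with success probability at most \<open>B V\<close>, where \<open>B\<close> bounds the density on the cube.
  Chernoff's method with parameter \<open>l = q \<le> 1\<close> (\<open>prob_count_deviation_le\<close>) shows that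
  \<open>\<bar>D(A) - P(A)\<bar> \<ge> C\<^sub>1 q V\<close> has probability at most \<open>2 exp (- (C\<^sub>1 - B) n V q\<^sup>2)\<close>. The choice of \<open>hl\<close> makes
  \<open>n hl\<^sup>d q\<^sup>2 = ln n\<close> (\<open>rate_identities\<close>), so this is a power of \<open>1/n\<close> whose exponent is as large as
  desired once \<open>C\<^sub>1\<close> is; it beats the number of bins and leaves \<open>1/n\<close>
  (\<open>hist_density_error_fixed_transform\<close>, \<open>failure_probability_le\<close>).

  Finally, the event itself has to be measurable. The estimator is jointly measurable in the sample,
  the transform and the point (\<open>borel_measurable_hist_density\<close>), and an essential supremum of a jointly
  measurable function is bounded by a constant on a measurable set of parameters
  (\<open>sets_Collect_AE\<close>).
\<close>

section \<open>Deviation of the number of observations in a set\<close>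

text \<open>For negative \<open>l\<close> the bound follows from \<open>exp l \<le> 1 / (1 - l)\<close> and
  \<open>(1 + l + l\<^sup>2) (1 - l) = 1 - l\<^sup>3 \<ge> 1\<close>.\<close>

lemma exp_le_one_plus_square:
  fixes l :: real
  assumes "\<bar>l\<bar> \<le> 1"
  shows "exp l \<le> 1 + l + l\<^sup>2"
proof (cases "0 \<le> l")
  case True
  then show ?thesis
    using assms exp_bound[of l] by simp
next
  case False
  then have pos: "0 < 1 - l" by simp
  have "1 - l \<le> exp (- l)"
    using exp_ge_add_one_self[of "- l"] by simp
  then have "exp l \<le> inverse (1 - l)"
    using pos by (metis exp_minus inverse_inverse_eq le_imp_inverse_le minus_minus)
  also have "\<dots> \<le> 1 + l + l\<^sup>2"
  proof -
    have "(1 + l + l\<^sup>2) * (1 - l) = 1 - l ^ 3"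
      by (simp add: algebra_simps power2_eq_square power3_eq_cube)
    moreover have "l ^ 3 \<le> 0"
      using False by (simp add: power_le_zero_eq)
    ultimately show ?thesis
      using pos by (simp add: inverse_eq_divide pos_divide_le_eq)
  qed
  finally show ?thesis .
qed

text \<open>The exponent contains the probability of \<open>A\<close>, not merely \<open>l\<^sup>2\<close> as in Hoeffding's lemma. This
  variance-type gain is essential: a bin has probability of the order of its small volume. It comes
  from \<open>1 + (e\<^sup>l - 1) p \<le> exp ((e\<^sup>l - 1) p)\<close> and \<open>e\<^sup>l - 1 - l \<le> l\<^sup>2\<close>.\<close>

lemma (in prob_space) expectation_exp_centred_indicator_le:
  assumes A: "A \<in> events" and l: "\<bar>l\<bar> \<le> 1"
  shows "(\<integral>\<^sup>+x. ennreal (exp (l * (indicator A x - prob A))) \<partial>M) \<le> ennreal (exp (prob A * l\<^sup>2))"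
proof -
  let ?p = "prob A"
  have int: "integrable M (\<lambda>x. exp (- (l * ?p)) * (1 + (exp l - 1) * indicator A x :: real))"
    using A by (intro integrable_mult_right integrable_add) (auto simp: emeasure_eq_measure)
  have eq: "exp (l * (indicator A x - ?p)) = exp (- (l * ?p)) * (1 + (exp l - 1) * indicator A x)" for x
    by (auto simp: indicator_def algebra_simps exp_add[symmetric] exp_minus exp_diff divide_simps)
  have "expectation (\<lambda>x. exp (- (l * ?p)) * (1 + (exp l - 1) * indicator A x))
      = exp (- (l * ?p)) * (1 + (exp l - 1) * ?p)"
    using A by (simp add: emeasure_eq_measure prob_space)
  also have "\<dots> \<le> exp (- (l * ?p)) * exp ((exp l - 1) * ?p)"
    by (intro mult_left_mono exp_ge_add_one_self) auto
  also have "\<dots> = exp ((exp l - 1 - l) * ?p)"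
    by (simp add: exp_add[symmetric] algebra_simps)
  also have "\<dots> \<le> exp (?p * l\<^sup>2)"
    using mult_right_mono[of "exp l - 1 - l" "l\<^sup>2" ?p] exp_le_one_plus_square[OF l]
    by (simp add: mult.commute)
  finally have "expectation (\<lambda>x. exp (- (l * ?p)) * (1 + (exp l - 1) * indicator A x)) \<le> exp (?p * l\<^sup>2)" .
  then show ?thesis
    using int by (subst eq, subst nn_integral_eq_integral) (auto simp: eq[symmetric] intro: ennreal_leI)
qed

text \<open>Chernoff's method: Markov's inequality for \<open>exp (l (S - n p))\<close>, whose expectation factorises over the
  independent observations. Both signs of \<open>l\<close> are allowed, so that this covers either tail.\<close>

lemma (in prob_space) prob_count_tail_le:
  assumes A: "A \<in> events" and l: "\<bar>l\<bar> \<le> 1"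
  shows "measure (\<Pi>\<^sub>M i\<in>{..<n}. M)
      {X \<in> space (\<Pi>\<^sub>M i\<in>{..<n}. M). a \<le> l * ((\<Sum>i<n. indicator A (X i)) - real n * prob A)}
    \<le> exp (real n * prob A * l\<^sup>2 - a)"
proof -
  let ?p = "prob A" and ?M = "\<Pi>\<^sub>M i\<in>{..<n}. M"
  interpret PP: product_prob_space "\<lambda>i::nat. M" "{..<n}" ..
  let ?E = "{X \<in> space ?M. a \<le> l * ((\<Sum>i<n. indicator A (X i)) - real n * ?p)}"
  note A[measurable]
  have E: "?E \<in> sets ?M" by measurable
  have "emeasure ?M ?E = (\<integral>\<^sup>+X. indicator ?E X \<partial>?M)"
    using E by simp
  also have "\<dots> \<le> (\<integral>\<^sup>+X. ennreal (exp (- a)) * (\<Prod>i<n. ennreal (exp (l * (indicator A (X i) - ?p)))) \<partial>?M)"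
  proof (intro nn_integral_mono)
    fix X
    have "exp (- a) * (\<Prod>i<n. exp (l * (indicator A (X i) - ?p)))
      = exp (l * ((\<Sum>i<n. indicator A (X i)) - real n * ?p) - a)"
      by (simp add: exp_sum[symmetric] exp_add[symmetric] sum_distrib_left[symmetric] sum_subtractf
          right_diff_distrib)
    then show "indicator ?E X \<le> ennreal (exp (- a)) * (\<Prod>i<n. ennreal (exp (l * (indicator A (X i) - ?p))))"
      by (auto simp: indicator_def[of ?E] prod_ennreal ennreal_mult[symmetric] prod_nonneg
          simp flip: ennreal_1 intro!: ennreal_leI)
  qed
  also have "\<dots> = ennreal (exp (- a)) * (\<integral>\<^sup>+X. (\<Prod>i<n. ennreal (exp (l * (indicator A (X i) - ?p)))) \<partial>?M)"
    by (rule nn_integral_cmult) measurable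
  also have "(\<integral>\<^sup>+X. (\<Prod>i<n. ennreal (exp (l * (indicator A (X i) - ?p)))) \<partial>?M)
      = (\<Prod>i<n. (\<integral>\<^sup>+x. ennreal (exp (l * (indicator A x - ?p))) \<partial>M))"
    by (rule PP.product_nn_integral_prod) auto
  also have "\<dots> \<le> (\<Prod>i<n. ennreal (exp (?p * l\<^sup>2)))"
    by (intro prod_mono_ennreal expectation_exp_centred_indicator_le A l)
  also have "\<dots> = ennreal (exp (real n * ?p * l\<^sup>2))"
    by (simp add: ennreal_power exp_of_nat_mult[symmetric] mult.assoc)
  also have "ennreal (exp (- a)) * ennreal (exp (real n * ?p * l\<^sup>2)) = ennreal (exp (real n * ?p * l\<^sup>2 - a))"
    by (simp add: ennreal_mult[symmetric] exp_add[symmetric])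
  finally have "emeasure ?M ?E \<le> ennreal (exp (real n * ?p * l\<^sup>2 - a))"
    by (simp add: mult_left_mono)
  then show ?thesis
    by (simp add: PP.emeasure_eq_measure)
qed

lemma (in prob_space) prob_count_deviation_le:
  assumes A: "A \<in> events" and l: "0 \<le> l" "l \<le> 1"
  shows "measure (\<Pi>\<^sub>M i\<in>{..<n}. M)
      {X \<in> space (\<Pi>\<^sub>M i\<in>{..<n}. M). t \<le> \<bar>(\<Sum>i<n. indicator A (X i)) - real n * prob A\<bar>}
    \<le> 2 * exp (real n * prob A * l\<^sup>2 - l * t)"
proof -
  let ?M = "\<Pi>\<^sub>M i\<in>{..<n}. M"
  interpret PP: product_prob_space "\<lambda>i::nat. M" "{..<n}" ..
  let ?E = "\<lambda>l'. {X \<in> space ?M. l * t \<le> l' * ((\<Sum>i<n. indicator A (X i)) - real n * prob A)}"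
  note A[measurable]
  have "measure ?M {X \<in> space ?M. t \<le> \<bar>(\<Sum>i<n. indicator A (X i)) - real n * prob A\<bar>}
    \<le> measure ?M (?E l \<union> ?E (- l))"
  proof (rule PP.finite_measure_mono)
    show "{X \<in> space ?M. t \<le> \<bar>(\<Sum>i<n. indicator A (X i)) - real n * prob A\<bar>} \<subseteq> ?E l \<union> ?E (- l)"
      using l(1) by (auto simp: abs_if split: if_splits dest!: mult_left_mono[of t _ l])
        (auto simp: algebra_simps)
  qed measurable
  also have "\<dots> \<le> measure ?M (?E l) + measure ?M (?E (- l))"
    by (rule measure_Un_le) measurable
  also have "\<dots> \<le> 2 * exp (real n * prob A * l\<^sup>2 - l * t)"
    using prob_count_tail_le[OF A, of l n "l * t"] prob_count_tail_le[OF A, of "- l" n "l * t"] l by simp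
  finally show ?thesis .
qed

section \<open>Essential suprema depending on a parameter\<close>

text \<open>The exceptional set in \<open>y\<close> is a section of a measurable set of the product, and its measure depends
  measurably on \<open>x\<close>. This turns an essential supremum, which is uncountable in nature, into a
  measurable function of a parameter.\<close>

lemma (in sigma_finite_measure) sets_Collect_AE:
  assumes Q: "{w \<in> space (N \<Otimes>\<^sub>M M). Q (fst w) (snd w)} \<in> sets (N \<Otimes>\<^sub>M M)"
  shows "{x \<in> space N. AE y in M. Q x y} \<in> sets N"
proof -
  let ?B = "{w \<in> space (N \<Otimes>\<^sub>M M). \<not> Q (fst w) (snd w)}"
  have B: "?B \<in> sets (N \<Otimes>\<^sub>M M)"
    using Q by (rule sets.sets_Collect_neg)
  have "(AE y in M. Q x y) \<longleftrightarrow> emeasure M (Pair x -` ?B) = 0" if "x \<in> space N" for x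
    using sets_Pair1[OF B, of x] that
    by (intro AE_iff_measurable) (auto simp: space_pair_measure)
  then have "{x \<in> space N. AE y in M. Q x y} = {x \<in> space N. emeasure M (Pair x -` ?B) = 0}"
    by auto
  also have "\<dots> \<in> sets N"
    using measurable_emeasure_Pair[OF B] by measurable
  finally show ?thesis .
qed

text \<open>The essential supremum of a non-measurable function is infinite by convention, so measurability is
  what makes the implication from right to left true.\<close>

lemma Linf_norm_le_iff:
  assumes [measurable]: "g \<in> borel_measurable M" and c: "0 \<le> c"
  shows "Linf_norm M g \<le> ennreal c \<longleftrightarrow> (AE x in M. \<bar>g x\<bar> \<le> c)"
proof
  assume "Linf_norm M g \<le> ennreal c"
  with esssup_AE[of "\<lambda>x. ennreal \<bar>g x\<bar>" M] show "AE x in M. \<bar>g x\<bar> \<le> c"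
    unfolding Linf_norm_def using c
    by (auto elim!: eventually_mono simp flip: ennreal_le_iff intro: order_trans)
next
  assume "AE x in M. \<bar>g x\<bar> \<le> c"
  then show "Linf_norm M g \<le> ennreal c"
    unfolding Linf_norm_def by (intro esssup_I) (auto elim!: eventually_mono intro: ennreal_leI)
qed

section \<open>Measurability of the histogram density estimator\<close>

text \<open>The measurable structure carried by every law of histogram transform parameters.\<close>

abbreviation ht_params_borel :: "'d::finite ht_params measure"
  where "ht_params_borel \<equiv> borel \<Otimes>\<^sub>M ((\<Pi>\<^sub>M i\<in>UNIV. borel) \<Otimes>\<^sub>M borel)"

lemma borel_measurable_vec_nth [measurable (raw)]:
  assumes "g \<in> M \<rightarrow>\<^sub>M borel"
  shows "(\<lambda>w. (g w :: 'a::topological_space ^ 'n) $ i) \<in> M \<rightarrow>\<^sub>M borel"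
  using assms by (rule measurable_compose) (intro borel_measurable_continuous_onI continuous_intros)

lemma hist_transform_nth:
  "hist_transform \<theta> x $ i
    = (\<Sum>j\<in>UNIV. fst \<theta> $ i $ j * fst (snd \<theta>) j * x $ j) + snd (snd \<theta>) $ i"
proof -
  have *: "(if l = j then g l else 0) * c = (if l = j then g j * c else 0)" for l j and g :: "_ \<Rightarrow> real" and c
    by simp
  show ?thesis
    by (cases \<theta>)
      (simp add: hist_transform_def diag_matrix_def matrix_vector_mult_def matrix_matrix_mult_def if_distrib
        cong: if_cong)
qed

lemma borel_measurable_hist_transform_nth [measurable (raw)]:
  fixes \<theta> :: "'a \<Rightarrow> 'd::finite ht_params"
  assumes [measurable]: "\<theta> \<in> M \<rightarrow>\<^sub>M ht_params_borel" "x \<in> M \<rightarrow>\<^sub>M borel"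
  shows "(\<lambda>w. hist_transform (\<theta> w) (x w) $ i) \<in> borel_measurable M"
  unfolding hist_transform_nth by measurable

lemma pred_bin [measurable (raw)]:
  fixes \<theta> :: "'a \<Rightarrow> 'd::finite ht_params"
  assumes [measurable]: "\<theta> \<in> M \<rightarrow>\<^sub>M ht_params_borel" "x \<in> M \<rightarrow>\<^sub>M borel" "y \<in> M \<rightarrow>\<^sub>M borel"
  shows "Measurable.pred M (\<lambda>w. y w \<in> bin (hist_transform (\<theta> w)) (x w))"
  unfolding bin_def mem_Collect_eq by measurable

lemma sets_bin [measurable, simp]: "bin (hist_transform \<theta>) x \<in> sets borel"
proof -
  have "Measurable.pred borel (\<lambda>y. y \<in> bin (hist_transform \<theta>) x)"
    by (rule pred_bin) (auto simp: space_pair_measure space_PiM)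
  then show ?thesis by (simp add: pred_def)
qed

lemma cube_eq_cbox: "cube r = cbox (\<chi> i. - r) (\<chi> i. r)"
  by (auto simp: cube_def mem_box_cart)

lemma sets_cube [measurable, simp]: "cube r \<in> sets borel"
  by (simp add: cube_eq_cbox)

lemma inner_cube_eq_cbox: "inner_cube r \<delta> = cbox (\<chi> i. \<delta>) (\<chi> i. r - \<delta>)"
  by (auto simp: inner_cube_def mem_box_cart)

lemma sets_inner_cube [measurable, simp]: "inner_cube r \<delta> \<in> sets borel"
  by (simp add: inner_cube_eq_cbox)

text \<open>The denominator is the Lebesgue measure of a section of a measurable set, so joint measurability
  in the sample, the transform and the point is a Fubini-type fact. The numerator is a finite sum of
  indicators.\<close>

lemma borel_measurable_hist_density:
  fixes \<theta> :: "'a \<Rightarrow> 'd::finite ht_params"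
  assumes n: "n \<ge> 1"
    and [measurable]: "\<theta> \<in> M \<rightarrow>\<^sub>M ht_params_borel" "x \<in> M \<rightarrow>\<^sub>M borel"
      "X \<in> M \<rightarrow>\<^sub>M (\<Pi>\<^sub>M i\<in>{..<n}. borel)"
  shows "(\<lambda>w. hist_density r (empirical_measure n (X w)) (hist_transform (\<theta> w)) (x w)) \<in> borel_measurable M"
proof -
  have [measurable]: "(\<lambda>w. measure lborel (bin (hist_transform (\<theta> w)) (x w) \<inter> cube r)) \<in> borel_measurable M"
    unfolding measure_def
    by (intro borel_measurable_enn2real lborel.measurable_emeasure) (simp, unfold Int_iff, measurable)
  have [measurable]: "(\<lambda>w. indicator (bin (hist_transform (\<theta> w)) (x w) \<inter> cube r) (X w i) :: real) \<in> borel_measurable M"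
    if [measurable]: "i \<in> {..<n}" for i
    unfolding indicator_def Int_iff by measurable
  have "(\<lambda>w. \<Sum>i<n. indicator (bin (hist_transform (\<theta> w)) (x w) \<inter> cube r) (X w i) :: real) \<in> borel_measurable M"
    by (intro borel_measurable_sum) measurable
  note [measurable] = this
  show ?thesis
    unfolding hist_density_def
    by (subst measure_empirical_measure) (use n in auto)
qed

section \<open>The law of the histogram transform\<close>

lemma sets_hist_transform_law:
  assumes "sets \<rho> = sets borel"
  shows "sets (hist_transform_law \<rho> hl hu) = sets (ht_params_borel :: 'd::finite ht_params measure)"
  unfolding hist_transform_law_def stretch_law_def
  by (intro sets_pair_measure_cong sets_PiM_cong) (auto simp: assms)

lemma prob_space_uniform_interval:
  assumes "a \<le> b"
  shows "prob_space (uniform_interval a b)"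
  using assms unfolding uniform_interval_def
  by (auto intro!: prob_space_uniform_measure prob_space_return)

lemma sets_uniform_interval [simp, measurable_cong]: "sets (uniform_interval a b) = sets borel"
  by (simp add: uniform_interval_def)

lemma prob_space_stretch_law:
  assumes "0 < hl" "hl \<le> hu"
  shows "prob_space (stretch_law hl hu)"
  unfolding stretch_law_def using assms
  by (intro prob_space.prob_space_distr prob_space_uniform_interval) (auto simp: frac_le)

text \<open>The point mass in the degenerate case \<open>a = b\<close> satisfies the bounds as well.\<close>

lemma AE_uniform_interval:
  assumes "a \<le> b"
  shows "AE u in uniform_interval a b. a \<le> u \<and> u \<le> b"
proof (cases "a < b")
  case True
  then have "AE u in uniform_measure lborel {a..b}. u \<in> {a..b}"
    by (intro AE_uniform_measureI) auto
  then show ?thesis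
    using True by (simp only: uniform_interval_def atLeastAtMost_iff if_True)
next
  case False
  with assms have "a = b" "uniform_interval a b = return borel b"
    by (auto simp: uniform_interval_def)
  then show ?thesis
    unfolding \<open>uniform_interval a b = return borel b\<close> by (subst AE_return) auto
qed

lemma AE_stretch_law:
  assumes "0 < hl" "hl \<le> hu"
  shows "AE s in stretch_law hl hu. 1 / hu \<le> s \<and> s \<le> 1 / hl"
proof -
  let ?a = "ln (1 / hu)" and ?b = "ln (1 / hl)"
  have exps: "exp ?a = 1 / hu" "exp ?b = 1 / hl"
    using assms by auto
  have ab: "?a \<le> ?b"
    using assms by (simp add: frac_le)
  have "AE u in uniform_interval ?a ?b. ?a \<le> u \<and> u \<le> ?b"
    by (rule AE_uniform_interval[OF ab])
  then have "AE u in uniform_interval ?a ?b. 1 / hu \<le> exp u \<and> exp u \<le> 1 / hl"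
    by eventually_elim (metis exps exp_le_cancel_iff)
  then show ?thesis
    unfolding stretch_law_def by (subst AE_distr_iff) auto
qed

lemma prob_space_pair:
  assumes "prob_space M" "prob_space N"
  shows "prob_space (M \<Otimes>\<^sub>M N)"
proof -
  interpret M: prob_space M by fact
  interpret N: prob_space N by fact
  interpret pair_prob_space M N ..
  show ?thesis by (rule prob_space_axioms)
qed

lemma AE_fst:
  assumes N: "prob_space N" and "AE x in M. Q x"
  shows "AE w in M \<Otimes>\<^sub>M N. Q (fst w)"
proof -
  interpret N: prob_space N by fact
  show ?thesis
    using assms(2) by (intro AE_distrD[OF measurable_fst]) (subst prob_space.distr_pair_fst[OF N])
qed

lemma AE_snd:
  assumes M: "prob_space M" and N: "prob_space N" and Q: "AE x in N. Q x"
  shows "AE w in M \<Otimes>\<^sub>M N. Q (snd w)"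
proof -
  interpret M: prob_space M by fact
  interpret N: prob_space N by fact
  interpret pair_sigma_finite N M ..
  have "AE w in N \<Otimes>\<^sub>M M. Q (fst w)"
    by (rule AE_fst[OF M Q])
  then have "AE w in distr (M \<Otimes>\<^sub>M N) (N \<Otimes>\<^sub>M M) (\<lambda>(x, y). (y, x)). Q (fst w)"
    by (subst (asm) distr_pair_swap)
  then show ?thesis
    by (drule_tac AE_distrD[OF measurable_pair_swap']) (simp add: case_prod_beta)
qed

lemma prob_space_uniform_unit_cube:
  "prob_space (uniform_measure lborel {b :: real ^ 'd::finite. \<forall>i. 0 \<le> b $ i \<and> b $ i \<le> 1})"
proof -
  have *: "{b :: real ^ 'd. \<forall>i. 0 \<le> b $ i \<and> b $ i \<le> 1} = cbox 0 1"
    by (auto simp: mem_box_cart)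
  have "measure lborel (cbox 0 (1 :: real ^ 'd)) = 1"
    by (subst content_cbox_cart) (auto simp: interval_ne_empty_cart)
  then show ?thesis
    unfolding * by (intro prob_space_uniform_measure) (auto simp: measure_def)
qed

lemma prob_space_hist_transform_law:
  assumes "prob_space \<rho>" "0 < hl" "hl \<le> hu"
  shows "prob_space (hist_transform_law \<rho> hl hu)"
  unfolding hist_transform_law_def
  by (intro prob_space_pair prob_space_PiM prob_space_stretch_law prob_space_uniform_unit_cube assms)

text \<open>These are the conditions under which the geometric estimates for the bins hold.\<close>

lemma AE_hist_transform_law:
  fixes \<rho> :: "(real ^ 'd::finite ^ 'd) measure"
  assumes \<rho>: "uniform_rotation \<rho>" and h: "0 < hl" "hl \<le> hu"
  shows "AE \<theta> in hist_transform_law \<rho> hl hu.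
    rotation_matrix (fst \<theta>) \<and> (\<forall>i. 1 / hu \<le> fst (snd \<theta>) i \<and> fst (snd \<theta>) i \<le> 1 / hl)"
proof -
  let ?S = "\<Pi>\<^sub>M i\<in>(UNIV :: 'd set). stretch_law hl hu"
  let ?U = "uniform_measure lborel {b :: real ^ 'd. \<forall>i. 0 \<le> b $ i \<and> b $ i \<le> 1}"
  have prob: "prob_space \<rho>" "prob_space ?S" "prob_space ?U" "prob_space (?S \<Otimes>\<^sub>M ?U)"
    using \<rho> unfolding uniform_rotation_def
    by (auto intro!: prob_space_pair prob_space_PiM prob_space_stretch_law h prob_space_uniform_unit_cube)
  have "AE R in \<rho>. rotation_matrix R"
    using \<rho> by (simp add: uniform_rotation_def)
  then have R: "AE \<theta> in \<rho> \<Otimes>\<^sub>M (?S \<Otimes>\<^sub>M ?U). rotation_matrix (fst \<theta>)"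
    by (rule AE_fst[OF prob(4)])
  have "AE s in ?S. 1 / hu \<le> s i \<and> s i \<le> 1 / hl" for i
    by (rule AE_PiM_component) (simp_all only: prob_space_stretch_law AE_stretch_law h UNIV_I)
  then have "AE s in ?S. \<forall>i. 1 / hu \<le> s i \<and> s i \<le> 1 / hl"
    by (subst AE_all_countable) blast
  then have "AE sb in ?S \<Otimes>\<^sub>M ?U. \<forall>i. 1 / hu \<le> fst sb i \<and> fst sb i \<le> 1 / hl"
    by (rule AE_fst[OF prob(3)])
  then have "AE \<theta> in \<rho> \<Otimes>\<^sub>M (?S \<Otimes>\<^sub>M ?U). \<forall>i. 1 / hu \<le> fst (snd \<theta>) i \<and> fst (snd \<theta>) i \<le> 1 / hl"
    by (rule AE_snd[OF prob(1) prob(4)])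
  with R show ?thesis
    unfolding hist_transform_law_def by eventually_elim simp
qed

section \<open>Geometry of the bins\<close>

lemma norm_rotation_mult:
  fixes R :: "real ^ 'd ^ 'd"
  assumes "rotation_matrix R"
  shows "norm (R *v x) = norm x"
  using assms orthogonal_transformation_matrix[of "(*v) R"]
  by (auto simp: rotation_matrix_def intro: orthogonal_transformation_norm)

lemma hist_transform_diff:
  "hist_transform (R, s, b) x - hist_transform (R, s, b) y = R *v (diag_matrix s *v (x - y))"
  by (simp add: hist_transform_def matrix_vector_mul_assoc matrix_vector_mult_diff_distrib)

lemma diag_matrix_mult_nth: "(diag_matrix s *v x) $ i = s i * x $ i"
proof -
  have "(if i = j then s i else 0) * x $ j = (if i = j then s i * x $ j else 0)" for j
    by simp
  then show ?thesis
    by (simp add: diag_matrix_def matrix_vector_mult_def)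
qed

lemma norm_vec_le_sqrt_CARD:
  fixes x :: "real ^ 'd"
  assumes "\<And>i. \<bar>x $ i\<bar> \<le> c"
  shows "norm x \<le> sqrt (real CARD('d)) * c"
proof -
  have c: "0 \<le> c"
    using assms abs_ge_zero order_trans by blast
  have "(norm x)\<^sup>2 = (\<Sum>i\<in>UNIV. (x $ i)\<^sup>2)"
    by (simp add: norm_vec_def L2_set_def sum_nonneg)
  also have "\<dots> \<le> (\<Sum>i\<in>(UNIV :: 'd set). c\<^sup>2)"
    using assms by (intro sum_mono) (metis abs_ge_zero power2_abs power_mono)
  also have "\<dots> = (sqrt (real CARD('d)) * c)\<^sup>2"
    by (simp add: power_mult_distrib)
  finally show ?thesis
    by (rule power2_le_imp_le) (use c in simp)
qed

text \<open>Within a bin the transformed points differ by at most \<open>1\<close> in every coordinate; the rotation is an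
  isometry and the stretching expands distances at least by the factor \<open>1 / hu\<close>.\<close>

lemma norm_diff_bin_le:
  fixes \<theta> :: "'d::finite ht_params"
  assumes \<theta>: "rotation_matrix (fst \<theta>)" "\<And>i. 1 / hu \<le> fst (snd \<theta>) i"
    and hu: "0 < hu"
    and y: "y \<in> bin (hist_transform \<theta>) x"
  shows "norm (x - y) \<le> sqrt (real CARD('d)) * hu"
proof -
  obtain R s b where \<theta>_eq: "\<theta> = (R, s, b)" by (cases \<theta>)
  let ?H = "hist_transform \<theta>"
  have "\<bar>(?H x - ?H y) $ i\<bar> \<le> 1" for i
  proof -
    have "\<lfloor>?H y $ i\<rfloor> = \<lfloor>?H x $ i\<rfloor>"
      using y unfolding bin_def by blast
    then show ?thesis
      unfolding vector_minus_component by linarith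
  qed
  then have le: "norm (?H x - ?H y) \<le> sqrt (real CARD('d)) * 1"
    by (rule norm_vec_le_sqrt_CARD)
  have "norm (x - y) / hu = norm ((1 / hu) *\<^sub>R (x - y))"
    using hu by simp
  also have "\<dots> \<le> norm (diag_matrix s *v (x - y))"
  proof (rule norm_le_componentwise_cart)
    fix i
    show "norm (((1 / hu) *\<^sub>R (x - y)) $ i) \<le> norm ((diag_matrix s *v (x - y)) $ i)"
      using mult_right_mono[of "1 / hu" "\<bar>s i\<bar>" "\<bar>(x - y) $ i\<bar>"] \<theta>(2)[of i] hu
      by (simp add: diag_matrix_mult_nth \<theta>_eq abs_mult)
  qed
  also have "\<dots> = norm (?H x - ?H y)"
    using \<theta>(1) by (simp add: \<theta>_eq hist_transform_diff norm_rotation_mult)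
  also have "\<dots> \<le> sqrt (real CARD('d))"
    using le by simp
  finally show ?thesis
    using hu by (simp only: pos_divide_le_eq)
qed

text \<open>The inverse is explicit: subtract the translation, rotate back by the transposed matrix, and undo
  the stretching coordinatewise.\<close>

lemma surj_hist_transform:
  fixes \<theta> :: "'d::finite ht_params"
  assumes \<theta>: "rotation_matrix (fst \<theta>)" "\<And>i. 0 < fst (snd \<theta>) i"
  shows "surj (hist_transform \<theta>)"
proof (rule surjI)
  fix u
  obtain R s b where \<theta>_eq: "\<theta> = (R, s, b)" by (cases \<theta>)
  let ?w = "transpose R *v (u - b)"
  have "diag_matrix s *v (\<chi> i. ?w $ i / s i) = ?w"
    using \<theta>(2) by (simp add: vec_eq_iff diag_matrix_mult_nth \<theta>_eq less_imp_neq[symmetric])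
  moreover have "R *v ?w = u - b"
    using \<theta>(1)
    by (simp add: \<theta>_eq rotation_matrix_def orthogonal_matrix_def matrix_vector_mul_assoc
        del: transpose_matrix_vector)
  ultimately show "hist_transform \<theta> (\<chi> i. (transpose (fst \<theta>) *v (u - snd (snd \<theta>))) $ i / fst (snd \<theta>) i) = u"
    by (simp add: \<theta>_eq hist_transform_def matrix_vector_mul_assoc[symmetric]
        del: transpose_matrix_vector)
qed

lemma fmeasurable_bin:
  fixes \<theta> :: "'d::finite ht_params"
  assumes \<theta>: "rotation_matrix (fst \<theta>)" "\<And>i. 1 / hu \<le> fst (snd \<theta>) i" and hu: "0 < hu"
  shows "bin (hist_transform \<theta>) x \<in> fmeasurable lborel"
proof -
  have "bin (hist_transform \<theta>) x \<subseteq> cball x (sqrt (real CARD('d)) * hu)"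
    using norm_diff_bin_le[OF \<theta> hu] by (auto simp: dist_norm)
  moreover have "emeasure lborel (cball x (sqrt (real CARD('d)) * hu)) < \<infinity>"
    by (intro emeasure_bounded_finite bounded_cball)
  ultimately show ?thesis
    using emeasure_mono[of "bin (hist_transform \<theta>) x" "cball x (sqrt (real CARD('d)) * hu)" lborel]
    by (intro fmeasurableI) (auto simp: le_less_trans)
qed

lemma norm_hist_transform_diff_le:
  fixes \<theta> :: "'d::finite ht_params"
  assumes \<theta>: "rotation_matrix (fst \<theta>)" "\<And>i. \<bar>fst (snd \<theta>) i\<bar> \<le> c"
  shows "norm (hist_transform \<theta> x - hist_transform \<theta> y) \<le> c * norm (x - y)"
proof -
  obtain R s b where \<theta>_eq: "\<theta> = (R, s, b)" by (cases \<theta>)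
  have c: "0 \<le> c"
    using \<theta>(2) abs_ge_zero order_trans by blast
  have "norm (hist_transform \<theta> x - hist_transform \<theta> y) = norm (diag_matrix s *v (x - y))"
    using \<theta>(1) by (simp add: \<theta>_eq hist_transform_diff norm_rotation_mult)
  also have "\<dots> \<le> norm (c *\<^sub>R (x - y))"
  proof (rule norm_le_componentwise_cart)
    fix i
    show "norm ((diag_matrix s *v (x - y)) $ i) \<le> norm ((c *\<^sub>R (x - y)) $ i)"
      using mult_right_mono[of "\<bar>s i\<bar>" c "\<bar>(x - y) $ i\<bar>"] \<theta>(2)[of i] c
      by (simp add: diag_matrix_mult_nth \<theta>_eq abs_mult)
  qed
  finally show ?thesis using c by simp
qed

text \<open>The ball lies around the preimage of the centre of the unit cube that the bin is mapped into: the
  transform expands distances at most by the factor \<open>1 / hl\<close>, and the centre has distance \<open>1 / 2\<close>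
  from the faces.\<close>

lemma ball_subset_bin:
  fixes \<theta> :: "'d::finite ht_params"
  assumes \<theta>: "rotation_matrix (fst \<theta>)"
    "\<And>i. 0 < fst (snd \<theta>) i" "\<And>i. fst (snd \<theta>) i \<le> 1 / hl"
    and hl: "0 < hl"
  obtains z where "ball z (hl / 2) \<subseteq> bin (hist_transform \<theta>) x"
proof -
  let ?H = "hist_transform \<theta>"
  obtain z where z: "?H z = (\<chi> i. real_of_int \<lfloor>?H x $ i\<rfloor> + 1 / 2)"
    using surjD[OF surj_hist_transform[OF \<theta>(1,2)]] by metis
  have "y \<in> bin ?H x" if y: "y \<in> ball z (hl / 2)" for y
  proof -
    have "\<lfloor>?H y $ i\<rfloor> = \<lfloor>?H x $ i\<rfloor>" for i
    proof -
      have "\<bar>(?H z - ?H y) $ i\<bar> \<le> norm (?H z - ?H y)"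
        by (rule component_le_norm_cart)
      also have "\<dots> \<le> 1 / hl * norm (z - y)"
        using \<theta>(2,3) by (intro norm_hist_transform_diff_le \<theta>(1)) (simp add: abs_of_pos)
      also have "\<dots> < 1 / 2"
        using y hl by (simp add: dist_norm divide_less_eq)
      finally have "\<bar>real_of_int \<lfloor>?H x $ i\<rfloor> + 1 / 2 - ?H y $ i\<bar> < 1 / 2"
        by (simp add: z)
      then show ?thesis
        by (intro floor_unique) linarith+
    qed
    then show ?thesis by (simp add: bin_def)
  qed
  then show ?thesis by (intro that[of z]) blast
qed

text \<open>Up to the constant this is the exact order of the volume \<open>h\<^sub>1 \<dots> h\<^sub>d\<close> of a bin; only the order
  matters for the rate, and the inscribed ball gives it without computing a determinant.\<close>

lemma measure_bin_ge:
  fixes \<theta> :: "'d::finite ht_params"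
  assumes \<theta>: "rotation_matrix (fst \<theta>)"
    "\<And>i. 1 / hu \<le> fst (snd \<theta>) i" "\<And>i. fst (snd \<theta>) i \<le> 1 / hl"
    and h: "0 < hl" "0 < hu"
  shows "unit_ball_vol (real CARD('d)) * (hl / 2) ^ CARD('d) \<le> measure lborel (bin (hist_transform \<theta>) x)"
proof -
  have pos: "0 < fst (snd \<theta>) i" for i
    using h(2) by (intro less_le_trans[OF _ \<theta>(2)]) simp
  obtain z where z: "ball z (hl / 2) \<subseteq> bin (hist_transform \<theta>) x"
    by (rule ball_subset_bin[OF \<theta>(1) pos \<theta>(3) h(1)])
  have "measure lborel (ball z (hl / 2)) \<le> measure lborel (bin (hist_transform \<theta>) x)"
    by (intro measure_mono_fmeasurable z fmeasurable_bin[OF \<theta>(1,2) h(2)]) simp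
  then show ?thesis
    using h(1) content_ball[of "hl / 2" z] by simp
qed

text \<open>Because of the margin left by the inner cube, a bin that meets it is not truncated by the boundary
  of the large cube.\<close>

lemma bin_subset_cube:
  fixes \<theta> :: "'d::finite ht_params"
  assumes \<theta>: "rotation_matrix (fst \<theta>)" "\<And>i. 1 / hu \<le> fst (snd \<theta>) i"
    and hu: "0 < hu" and x: "x \<in> inner_cube r (sqrt (real CARD('d)) * hu)"
  shows "bin (hist_transform \<theta>) x \<subseteq> cube r"
proof
  fix y assume "y \<in> bin (hist_transform \<theta>) x"
  then have "norm (x - y) \<le> sqrt (real CARD('d)) * hu"
    by (rule norm_diff_bin_le[OF \<theta> hu])
  then have "\<bar>x $ i - y $ i\<bar> \<le> sqrt (real CARD('d)) * hu" for i
    using component_le_norm_cart[of "x - y" i] by simp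
  then have "0 \<le> y $ i \<and> y $ i \<le> r" for i
    using x by (simp add: inner_cube_def abs_le_iff) (smt (verit))
  then show "y \<in> cube r"
    unfolding cube_def by (smt (verit) mem_Collect_eq)
qed

text \<open>Packing: disjoint sets of measure at least \<open>v\<close> inside a set of finite measure. The bound for finite
  subfamilies already forces the whole family to be finite.\<close>

lemma finite_disjoint_family_measure_ge:
  assumes disj: "disjoint \<C>" and sub: "\<And>A. A \<in> \<C> \<Longrightarrow> A \<in> sets M \<and> A \<subseteq> K \<and> v \<le> measure M A"
    and K: "K \<in> fmeasurable M" and v: "0 < v"
  shows "finite \<C>" and "real (card \<C>) \<le> measure M K / v"
proof -
  have bound: "real (card \<G>) \<le> measure M K / v" if \<G>: "\<G> \<subseteq> \<C>" "finite \<G>" for \<G>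
  proof -
    have fm: "A \<in> fmeasurable M" if "A \<in> \<G>" for A
      using fmeasurableI2[OF K] sub that \<G> by blast
    have "real (card \<G>) * v \<le> (\<Sum>A\<in>\<G>. measure M A)"
      using sum_mono[of \<G> "\<lambda>_. v" "measure M"] sub \<G> by auto
    also have "\<dots> = measure M (\<Union>\<G>)"
      using measure_Union'[of \<G> M] \<G> fm disj by (simp add: pairwise_subset)
    also have "\<dots> \<le> measure M K"
      using \<G> sub fm K by (intro measure_mono_fmeasurable) auto
    finally show ?thesis using v by (simp add: pos_le_divide_eq)
  qed
  have "card \<G> \<le> nat \<lfloor>measure M K / v\<rfloor>" if "\<G> \<subseteq> \<C>" "finite \<G>" for \<G>
    using bound[OF that] by (simp add: le_nat_floor)
  then show fin: "finite \<C>"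
    using finite_if_finite_subsets_card_bdd by blast
  then show "real (card \<C>) \<le> measure M K / v"
    by (intro bound) auto
qed

lemma disjoint_bins: "disjoint {bin H x |x. x \<in> S}"
  by (auto simp: disjoint_def bin_def)

section \<open>The error for a fixed histogram transform\<close>

lemma measure_density_bounds:
  fixes f :: "'a \<Rightarrow> real"
  assumes [measurable]: "f \<in> borel_measurable M"
    and A: "A \<in> fmeasurable M" and fA: "\<And>x. x \<in> A \<Longrightarrow> 0 \<le> f x \<and> lo \<le> f x \<and> f x \<le> hi"
  shows "lo * measure M A \<le> measure (density M f) A" and "measure (density M f) A \<le> hi * measure M A"
proof -
  have [measurable]: "A \<in> sets M" and eA: "emeasure M A = ennreal (measure M A)"
    using A by (auto simp: emeasure_eq_measure2)
  have eq: "emeasure (density M f) A = (\<integral>\<^sup>+x\<in>A. ennreal (f x) \<partial>M)"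
    by (rule emeasure_density) auto
  have "(\<integral>\<^sup>+x\<in>A. ennreal (f x) \<partial>M) \<le> (\<integral>\<^sup>+x\<in>A. ennreal (max 0 hi) \<partial>M)"
    using fA by (intro nn_integral_mono) (auto simp: indicator_def intro: ennreal_leI)
  then have upper: "emeasure (density M f) A \<le> ennreal (max 0 hi * measure M A)"
    by (simp add: eq eA nn_integral_cmult_indicator ennreal_mult')
  have "(\<integral>\<^sup>+x\<in>A. ennreal (max 0 lo) \<partial>M) \<le> (\<integral>\<^sup>+x\<in>A. ennreal (f x) \<partial>M)"
    using fA by (intro nn_integral_mono) (auto simp: indicator_def intro: ennreal_leI)
  then have lower: "ennreal (max 0 lo * measure M A) \<le> emeasure (density M f) A"
    by (simp add: eq eA nn_integral_cmult_indicator ennreal_mult')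
  have fin: "emeasure (density M f) A = ennreal (measure (density M f) A)"
    using upper by (intro emeasure_eq_ennreal_measure) (auto simp: top_unique)
  have "max 0 lo * measure M A \<le> measure (density M f) A"
    using lower unfolding fin by (simp add: ennreal_le_iff)
  then show "lo * measure M A \<le> measure (density M f) A"
    using mult_right_mono[of lo "max 0 lo" "measure M A"] by simp
  have "measure (density M f) A \<le> max 0 hi * measure M A"
    using upper unfolding fin by (simp add: ennreal_le_iff)
  moreover have "max 0 hi * measure M A = hi * measure M A"
  proof (cases "A = {}")
    case False
    then have "0 \<le> hi" using fA order.trans by blast
    then show ?thesis by simp
  qed simp
  ultimately show "measure (density M f) A \<le> hi * measure M A"
    by simp
qed

text \<open>The core estimate. The error at \<open>x\<close> with bin \<open>A\<close> of volume \<open>V\<close> splits into the stochastic part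
  \<open>(D(A) - P(A)) / V\<close> and the bias \<open>P(A) / V - f(x)\<close>. The bias is an average of \<open>f(y) - f(x)\<close> over
  points \<open>y\<close> at distance at most \<open>\<surd>d hu\<close>. The stochastic part exceeds \<open>t\<close> only if the number of
  observations in \<open>A\<close> deviates from its mean by \<open>n V t\<close>, which has probability at most
  \<open>2 exp (n P(A) l\<^sup>2 - n V l t) \<le> 2 exp (- n V l (t - B l))\<close> since \<open>P(A) \<le> B V\<close>. A union bound over the
  bins that meet the inner cube finishes the proof: \<open>v\<close> is a lower bound for their volumes, so
  that there are at most \<open>\<mu>(B\<^sub>r) / v\<close> of them. The good event is the complement of a finite union of
  measurable sets, and in particular measurable.\<close>

lemma hist_density_error_fixed_transform:
  fixes P :: "(real ^ 'd::finite) measure" and \<theta> :: "'d ht_params"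
  assumes P: "prob_space P" "P = density lborel (\<lambda>x. ennreal (f x))"
    and f: "f \<in> borel_measurable borel" "\<And>x. 0 \<le> f x"
    and holder: "\<And>x x'. x \<in> cube r \<Longrightarrow> x' \<in> cube r \<Longrightarrow> \<bar>f x - f x'\<bar> \<le> c * norm (x - x') powr \<alpha>"
    and c: "0 < c" "0 < \<alpha>"
    and B: "\<And>x. x \<in> cube r \<Longrightarrow> f x \<le> B"
    and \<theta>: "rotation_matrix (fst \<theta>)"
      "\<And>i. 1 / hu \<le> fst (snd \<theta>) i" "\<And>i. fst (snd \<theta>) i \<le> 1 / hl"
    and h: "0 < hl" "0 < hu"
    and v: "v = unit_ball_vol (real CARD('d)) * (hl / 2) ^ CARD('d)"
    and n: "1 \<le> n" and l: "0 \<le> l" "l \<le> 1" and t: "B * l \<le> t"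
  obtains E where "E \<in> sets (\<Pi>\<^sub>M i\<in>{..<n}. P)"
    and "1 - 2 * measure lborel (cube r :: (real ^ 'd) set) / v * exp (- (real n * v * (l * (t - B * l))))
      \<le> measure (\<Pi>\<^sub>M i\<in>{..<n}. P) E"
    and "\<And>X x. X \<in> E \<Longrightarrow> x \<in> inner_cube r (sqrt (real CARD('d)) * hu) \<Longrightarrow>
      \<bar>hist_density r (empirical_measure n X) (hist_transform \<theta>) x - f x\<bar>
        \<le> t + c * (sqrt (real CARD('d)) * hu) powr \<alpha>"
proof -
  let ?H = "hist_transform \<theta>" and ?I = "inner_cube r (sqrt (real CARD('d)) * hu) :: (real ^ 'd) set"
  let ?V = "\<lambda>A. measure lborel A" and ?M = "\<Pi>\<^sub>M i\<in>{..<n}. P"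
  let ?\<C> = "{bin ?H x |x. x \<in> ?I}"
  let ?q = "exp (- (real n * v * (l * (t - B * l))))"
  \<comment> \<open>The deviation on the left is that of the count; divided by \<open>n V\<close> it is the deviation \<open>t\<close> of
    the estimator.\<close>
  define Bad where "Bad A =
    {X \<in> space ?M. real n * ?V A * t \<le> \<bar>(\<Sum>i<n. indicator A (X i)) - real n * measure P A\<bar>}" for A
  interpret P: prob_space P by fact
  interpret PM: product_prob_space "\<lambda>i::nat. P" "{..<n}" ..
  have [simp, measurable_cong]: "sets P = sets borel"
    by (simp add: P(2))
  have v_pos: "0 < v"
    using h by (simp add: v)
  have cell: "A \<in> sets borel \<and> A \<in> fmeasurable lborel \<and> A \<subseteq> cube r \<and> v \<le> ?V A" if "A \<in> ?\<C>" for A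
    unfolding v using that bin_subset_cube[OF \<theta>(1,2) h(2)] measure_bin_ge[OF \<theta> h]
      fmeasurable_bin[OF \<theta>(1,2) h(2)] by auto
  have K: "(cube r :: (real ^ 'd) set) \<in> fmeasurable lborel"
    unfolding cube_eq_cbox by (rule fmeasurable_cbox)
  have "finite ?\<C>" and card: "real (card ?\<C>) \<le> ?V (cube r :: (real ^ 'd) set) / v"
    using finite_disjoint_family_measure_ge[OF disjoint_bins _ K v_pos, of ?H ?I] cell by auto
  have Bad_sets: "Bad A \<in> sets ?M" if "A \<in> ?\<C>" for A
  proof -
    have [measurable]: "A \<in> sets P" using cell[OF that] by simp
    show ?thesis unfolding Bad_def by measurable
  qed
  have Bad_le: "measure ?M (Bad A) \<le> 2 * ?q" if "A \<in> ?\<C>" for A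
  proof -
    have PA: "measure P A \<le> B * ?V A"
      unfolding P(2) using cell[OF that] B f by (intro measure_density_bounds(2)[of f lborel A 0]) auto
    have "measure ?M (Bad A) \<le> 2 * exp (real n * measure P A * l\<^sup>2 - l * (real n * ?V A * t))"
      unfolding Bad_def using cell[OF that] l by (intro P.prob_count_deviation_le) auto
    also have "\<dots> \<le> 2 * ?q"
    proof -
      have "real n * measure P A * l\<^sup>2 \<le> real n * (B * ?V A) * l\<^sup>2"
        using PA by (intro mult_right_mono mult_left_mono) auto
      moreover have "real n * v * (l * (t - B * l)) \<le> real n * ?V A * (l * (t - B * l))"
        using cell[OF that] l t by (intro mult_right_mono mult_left_mono) auto
      ultimately show ?thesis
        by (simp add: algebra_simps power2_eq_square)
    qed
    finally show ?thesis .
  qed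
  let ?E = "space ?M - (\<Union>A\<in>?\<C>. Bad A)"
  have Bads: "(\<Union>A\<in>?\<C>. Bad A) \<in> sets ?M"
    using \<open>finite ?\<C>\<close> Bad_sets by (intro sets.finite_UN) auto
  show ?thesis
  proof (rule that[of ?E])
    show "?E \<in> sets ?M"
      using Bads by auto
    have "measure ?M (\<Union>A\<in>?\<C>. Bad A) \<le> (\<Sum>A\<in>?\<C>. measure ?M (Bad A))"
      by (rule measure_UNION_le[OF \<open>finite ?\<C>\<close> Bad_sets])
    also have "\<dots> \<le> real (card ?\<C>) * (2 * ?q)"
      using sum_bounded_above[of ?\<C> "\<lambda>A. measure ?M (Bad A)"] Bad_le by simp
    also have "\<dots> \<le> ?V (cube r :: (real ^ 'd) set) / v * (2 * ?q)"
      using card by (rule mult_right_mono) simp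
    finally show "1 - 2 * ?V (cube r :: (real ^ 'd) set) / v * ?q \<le> measure ?M ?E"
      by (subst PM.prob_compl[OF Bads]) (simp add: mult.assoc mult.left_commute)
  next
    fix X x assume X: "X \<in> ?E" and x: "x \<in> ?I"
    define A where "A = bin ?H x"
    have A: "A \<in> ?\<C>" using x by (auto simp: A_def)
    note cA = cell[OF A]
    have V: "0 < ?V A" using cA v_pos by linarith
    have xA: "x \<in> A" by (simp add: A_def bin_def)
    let ?S = "\<Sum>i<n. indicator A (X i) :: real"
    have "hist_density r (empirical_measure n X) ?H x = ?S / real n / ?V A"
      using cA xA n by (auto simp: hist_density_def A_def[symmetric] measure_empirical_measure Int_absorb2)
    moreover have "\<bar>?S / real n / ?V A - measure P A / ?V A\<bar> \<le> t"
    proof -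
      have "\<bar>?S - real n * measure P A\<bar> \<le> real n * ?V A * t"
        using X A unfolding Bad_def by (auto simp: not_le)
      moreover have "?S / real n / ?V A - measure P A / ?V A = (?S - real n * measure P A) / (real n * ?V A)"
        using V n by (simp add: field_simps)
      ultimately show ?thesis
        using V n by (simp add: abs_divide abs_mult pos_divide_le_eq mult.commute)
    qed
    moreover have "\<bar>measure P A / ?V A - f x\<bar> \<le> c * (sqrt (real CARD('d)) * hu) powr \<alpha>"
    proof -
      let ?e = "c * (sqrt (real CARD('d)) * hu) powr \<alpha>"
      have fe: "0 \<le> f y \<and> f x - ?e \<le> f y \<and> f y \<le> f x + ?e" if "y \<in> A" for y
      proof -
        have "\<bar>f x - f y\<bar> \<le> c * norm (x - y) powr \<alpha>"
          using that xA cA by (intro holder) auto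
        also have "\<dots> \<le> ?e"
          using that norm_diff_bin_le[OF \<theta>(1,2) h(2), of y x] c
          by (intro mult_left_mono powr_mono2) (auto simp: A_def)
        finally show ?thesis using f(2)[of y] by linarith
      qed
      have "(f x - ?e) * ?V A \<le> measure P A" "measure P A \<le> (f x + ?e) * ?V A"
        unfolding P(2) using measure_density_bounds[of f lborel A "f x - ?e" "f x + ?e"] fe cA f(1) by auto
      then have "f x - ?e \<le> measure P A / ?V A" "measure P A / ?V A \<le> f x + ?e"
        using V by (simp_all add: pos_le_divide_eq pos_divide_le_eq)
      then show ?thesis by linarith
    qed
    ultimately show "\<bar>hist_density r (empirical_measure n X) ?H x - f x\<bar> \<le> t + c * (sqrt (real CARD('d)) * hu) powr \<alpha>"
      by linarith
  qed
qed

section \<open>Combining the sample and the random transform\<close>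

lemma borel_measurable_hist_density_slice:
  fixes \<theta> :: "'d::finite ht_params"
  assumes "1 \<le> n" "X \<in> space (\<Pi>\<^sub>M i\<in>{..<n}. borel)"
  shows "(\<lambda>x. hist_density r (empirical_measure n X) (hist_transform \<theta>) x) \<in> borel_measurable borel"
  using assms by (intro borel_measurable_hist_density measurable_const)
    (auto simp: space_pair_measure space_PiM)

text \<open>The measure of a non-measurable set is \<open>0\<close> by convention, so a lower bound for the probability of
  this event requires its measurability.\<close>

lemma sets_Linf_error_event:
  fixes P :: "(real ^ 'd::finite) measure" and \<Theta> :: "'d ht_params measure"
  assumes n: "1 \<le> n" and P: "sets P = sets borel" and \<Theta>: "sets \<Theta> = sets ht_params_borel"
    and f [measurable]: "f \<in> borel_measurable borel" and S [measurable]: "S \<in> sets borel" and c: "0 \<le> c"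
  shows "{(X, \<theta>) \<in> space ((\<Pi>\<^sub>M i\<in>{..<n}. P) \<Otimes>\<^sub>M \<Theta>).
      Linf_norm (restrict_space lborel S) (\<lambda>x. hist_density r (empirical_measure n X) (hist_transform \<theta>) x - f x)
        \<le> ennreal c} \<in> sets ((\<Pi>\<^sub>M i\<in>{..<n}. P) \<Otimes>\<^sub>M \<Theta>)"
proof -
  let ?N = "(\<Pi>\<^sub>M i\<in>{..<n}. P) \<Otimes>\<^sub>M \<Theta>"
  let ?g = "\<lambda>w x. hist_density r (empirical_measure n (fst w)) (hist_transform (snd w)) x - f x"
  have sets_PiM: "sets (\<Pi>\<^sub>M i\<in>{..<n}. P) = sets (\<Pi>\<^sub>M i\<in>{..<n}. borel)"
    using P by (intro sets_PiM_cong) auto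
  have sets_N: "sets ?N = sets ((\<Pi>\<^sub>M i\<in>{..<n}. borel) \<Otimes>\<^sub>M (ht_params_borel :: 'd ht_params measure))"
    by (intro sets_pair_measure_cong sets_PiM \<Theta>)
  have fst_N [measurable]: "fst \<in> ?N \<rightarrow>\<^sub>M (\<Pi>\<^sub>M i\<in>{..<n}. borel)"
    unfolding measurable_cong_sets[OF sets_N refl] by measurable
  have snd_N [measurable]: "snd \<in> ?N \<rightarrow>\<^sub>M ht_params_borel"
    unfolding measurable_cong_sets[OF sets_N refl] by measurable
  have joint [measurable]: "(\<lambda>w. ?g (fst w) (snd w)) \<in> borel_measurable (?N \<Otimes>\<^sub>M lborel)"
    by (intro borel_measurable_diff borel_measurable_hist_density n) measurable
  have slice: "?g w \<in> borel_measurable (restrict_space lborel S)" if "w \<in> space ?N" for w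
  proof -
    have "fst w \<in> space (\<Pi>\<^sub>M i\<in>{..<n}. borel)"
      using measurable_space[OF fst_N that] .
    then have "?g w \<in> borel_measurable borel"
      by (intro borel_measurable_diff borel_measurable_hist_density_slice n f)
    then show ?thesis
      by (intro measurable_restrict_space1) simp
  qed
  have "Linf_norm (restrict_space lborel S) (?g w) \<le> ennreal c \<longleftrightarrow> (AE x in lborel. x \<in> S \<longrightarrow> \<bar>?g w x\<bar> \<le> c)"
    if "w \<in> space ?N" for w
    using Linf_norm_le_iff[OF slice[OF that] c] by (simp add: AE_restrict_space_iff)
  then have "{(X, \<theta>) \<in> space ?N. Linf_norm (restrict_space lborel S)
        (\<lambda>x. hist_density r (empirical_measure n X) (hist_transform \<theta>) x - f x) \<le> ennreal c}
      = {w \<in> space ?N. AE x in lborel. x \<in> S \<longrightarrow> \<bar>?g w x\<bar> \<le> c}"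
    by auto
  also have "\<dots> \<in> sets ?N"
    by (rule lborel.sets_Collect_AE) measurable
  finally show ?thesis .
qed

text \<open>By Fubini's theorem the product measure is the average of the measures of the sections; this
  transfers the estimate for fixed transforms to a random one that is independent of the sample.\<close>

lemma prob_pair_ge_of_AE_slice:
  assumes M: "prob_space M" and N: "prob_space N" and E: "E \<in> sets (M \<Otimes>\<^sub>M N)"
    and slice: "AE y in N. q \<le> measure M ((\<lambda>x. (x, y)) -` E)"
  shows "q \<le> measure (M \<Otimes>\<^sub>M N) E"
proof -
  interpret M: prob_space M by fact
  interpret N: prob_space N by fact
  interpret pair_prob_space M N ..
  have "ennreal q = (\<integral>\<^sup>+y. ennreal q \<partial>N)"
    by (simp add: N.emeasure_space_1)
  also have "\<dots> \<le> (\<integral>\<^sup>+y. emeasure M ((\<lambda>x. (x, y)) -` E) \<partial>N)"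
    using slice by (intro nn_integral_mono_AE) (auto simp: M.emeasure_eq_measure intro: ennreal_leI)
  also have "\<dots> = emeasure (M \<Otimes>\<^sub>M N) E"
    by (rule emeasure_pair_measure_alt2[OF E, symmetric])
  finally show ?thesis
    by (simp add: emeasure_eq_measure)
qed

section \<open>The convergence rate\<close>

lemma half_le_ln:
  assumes "2 \<le> n"
  shows "1 / 2 \<le> ln (real n)"
proof -
  have "1 / 2 \<le> ln (2 :: real)"
    using ln_le_minus_one[of "1 / 2"] by (simp add: ln_div)
  also have "\<dots> \<le> ln (real n)" using assms by simp
  finally show ?thesis .
qed

text \<open>The bin width balances the two error terms: with \<open>l = h\<^sup>\<alpha>\<close>, the order of the bias, the exponent
  \<open>n h\<^sup>d l\<^sup>2\<close> of the deviation bound is exactly \<open>ln n\<close>. The last claim bounds the number of bins,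
  which is of order \<open>1 / h\<^sup>d\<close>, by a multiple of \<open>n\<close>.\<close>

lemma rate_identities:
  fixes \<alpha> h :: real and n d :: nat
  assumes n: "2 \<le> n" and \<alpha>: "0 < \<alpha>"
    and h: "h = (ln (real n) / real n) powr (1 / (2 * \<alpha> + real d))"
  shows "h powr \<alpha> = (ln (real n) / real n) powr (\<alpha> / (2 * \<alpha> + real d))"
    and "0 < h" and "h \<le> 1"
    and "real n * h ^ d * (h powr \<alpha> * h powr \<alpha>) = ln (real n)"
    and "1 \<le> 2 * real n * h ^ d"
proof -
  let ?q = "ln (real n) / real n"
  have q: "0 < ?q" "?q \<le> 1"
    using n ln_le_minus_one[of "real n"] by auto
  have D: "0 < 2 * \<alpha> + real d"
    using \<alpha> by (simp add: add_pos_nonneg)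
  show "h powr \<alpha> = ?q powr (\<alpha> / (2 * \<alpha> + real d))"
    by (simp add: h powr_powr)
  show h_pos: "0 < h"
    unfolding h using q(1) by (metis less_irrefl powr_gt_zero)
  show h_le: "h \<le> 1"
    unfolding h using q D powr_mono2[of "1 / (2 * \<alpha> + real d)" ?q 1] by simp
  have "2 * \<alpha> + real d = real d + (\<alpha> + \<alpha>)"
    by simp
  then have "h ^ d * (h powr \<alpha> * h powr \<alpha>) = h powr (2 * \<alpha> + real d)"
    by (simp only: powr_add powr_realpow[OF h_pos])
  also have "\<dots> = ?q"
  proof -
    have "1 / (2 * \<alpha> + real d) * (2 * \<alpha> + real d) = 1"
      using D by simp
    then show ?thesis
      unfolding h powr_powr using q by (simp only: powr_one)
  qed
  finally have hq: "h ^ d * (h powr \<alpha> * h powr \<alpha>) = ?q" .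
  then show "real n * h ^ d * (h powr \<alpha> * h powr \<alpha>) = ln (real n)"
    using n by (simp add: mult.assoc)
  have "h powr \<alpha> \<le> 1"
    using powr_mono2[of \<alpha> h 1] h_pos h_le \<alpha> by simp
  then have "h powr \<alpha> * h powr \<alpha> \<le> 1"
    by (simp add: mult_le_one)
  then have "?q \<le> h ^ d"
    using mult_left_mono[of "h powr \<alpha> * h powr \<alpha>" 1 "h ^ d"] h_pos hq by simp
  moreover note half_le_ln[OF n]
  ultimately have "1 \<le> 2 * (h ^ d * real n)"
    using n by (simp add: pos_divide_le_eq)
  then show "1 \<le> 2 * real n * h ^ d"
    by (simp only: ac_simps)
qed

text \<open>The factor \<open>a / b\<close> is the number of bins up to a constant and is at most \<open>2 a n\<close>. One \<open>ln n\<close> in \<open>e\<close>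
  compensates this \<open>n\<close>, the second one produces \<open>1 / n\<close>, and \<open>4 a ln n\<close> absorbs the constant \<open>2 a\<close>
  because \<open>2 a \<le> 4 a ln n \<le> exp (4 a ln n)\<close>.\<close>

lemma failure_probability_le:
  fixes a b :: real
  assumes n: "2 \<le> n" and a: "0 \<le> a" and b: "0 < b" "1 \<le> 2 * real n * b" and e: "e = (2 + 4 * a) * ln (real n)"
  shows "a / b * exp (- e) \<le> 1 / real n"
proof -
  note ln_n = half_le_ln[OF n]
  have "a / b \<le> a * (2 * real n)"
    using a b mult_left_mono[of 1 "2 * real n * b" a] by (simp add: pos_divide_le_eq mult.assoc)
  moreover have "2 * a \<le> exp (4 * a * ln (real n))"
  proof -
    have "2 * a \<le> 4 * a * ln (real n)"
      using mult_left_mono[OF ln_n, of "4 * a"] a by simp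
    also have "\<dots> \<le> exp (4 * a * ln (real n))"
      using exp_ge_add_one_self[of "4 * a * ln (real n)"] by linarith
    finally show ?thesis .
  qed
  moreover have "exp (- e) = 1 / (real n * real n * exp (4 * a * ln (real n)))"
  proof -
    have "exp e = exp (ln (real n) + ln (real n) + 4 * a * ln (real n))"
      by (simp add: e algebra_simps)
    also have "\<dots> = real n * real n * exp (4 * a * ln (real n))"
      using n unfolding exp_add by simp
    finally show ?thesis
      by (simp add: exp_minus inverse_eq_divide)
  qed
  moreover have "a * (2 * real n) * (1 / (real n * real n * exp (4 * a * ln (real n))))
      = (2 * a / exp (4 * a * ln (real n))) * (1 / real n)"
    using n by (simp add: field_simps)
  ultimately have "a / b * exp (- e) \<le> (2 * a / exp (4 * a * ln (real n))) * (1 / real n)"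
    by (smt (verit) exp_gt_zero mult_right_mono)
  also have "\<dots> \<le> 1 * (1 / real n)"
    using \<open>2 * a \<le> exp (4 * a * ln (real n))\<close> by (intro mult_right_mono) (auto simp: pos_divide_le_eq)
  finally show ?thesis by simp
qed

lemma holder_on_cube_bounded:
  fixes f :: "real ^ 'd::finite \<Rightarrow> real"
  assumes holder: "\<And>x x'. x \<in> cube r \<Longrightarrow> x' \<in> cube r \<Longrightarrow> \<bar>f x - f x'\<bar> \<le> c * norm (x - x') powr \<alpha>"
    and c: "0 < c" "0 < \<alpha>" and x: "x \<in> cube r"
  shows "f x \<le> f 0 + c * (sqrt (real CARD('d)) * r) powr \<alpha>"
proof -
  have "0 \<le> r"
    using x unfolding cube_def by (smt (verit) mem_Collect_eq)
  then have "0 \<in> cube r" by (simp add: cube_def)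
  then have "\<bar>f x - f 0\<bar> \<le> c * norm (x - 0) powr \<alpha>"
    using x by (intro holder)
  also have "norm (x - 0) \<le> sqrt (real CARD('d)) * r"
    using x by (intro norm_vec_le_sqrt_CARD) (auto simp: cube_def abs_le_iff minus_le_iff)
  then have "c * norm (x - 0) powr \<alpha> \<le> c * (sqrt (real CARD('d)) * r) powr \<alpha>"
    using c by (intro mult_left_mono powr_mono2) auto
  finally show ?thesis by simp
qed

theorem theorem5:
  fixes P :: "(real ^ 'd) measure"
    and f :: "real ^ 'd \<Rightarrow> real"
    and r \<alpha> :: real
    and hl hu c0 :: "nat \<Rightarrow> real"
    and \<rho> :: "(real ^ 'd ^ 'd) measure"
    and N :: "nat set"
  assumes "prob_space P"
    and "f \<in> borel_measurable borel" and "\<And>x. 0 \<le> f x"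
    and "P = density lborel (\<lambda>x. ennreal (f x))"
    and "r > 0" and "measure_support P \<subseteq> cube r"
    and "0 < \<alpha>" and "\<alpha> \<le> 1" and "holder_on \<alpha> (cube r) f"
    and "Linf_norm lborel f < \<infinity>"
    and "uniform_rotation \<rho>"
    and "\<And>n. hl n = (ln (real n) / real n) powr (1 / (2 * \<alpha> + real CARD('d)))"
    and "N = {n. 1 \<le> n \<and> 0 < hl n \<and> sqrt (real CARD('d)) * hu n < r / 2}"
    and "\<And>n. n \<in> N \<Longrightarrow> hl n \<le> hu n"
    and "\<And>n. n \<in> N \<Longrightarrow> 0 < c0 n \<and> c0 n < 1"
    and "\<exists>\<epsilon>>0. \<forall>n\<in>N. \<epsilon> \<le> c0 n"
    and "\<And>n. n \<in> N \<Longrightarrow> c0 n * hu n \<le> hl n \<and> hl n \<le> hu n / c0 n"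
  shows "\<exists>C>0. \<forall>n\<in>N.
    let \<nu> = (\<Pi>\<^sub>M i\<in>{..<n}. P) \<Otimes>\<^sub>M hist_transform_law \<rho> (hl n) (hu n) in
      measure \<nu> {(X, \<theta>) \<in> space \<nu>.
        Linf_norm (restrict_space lborel (inner_cube r (sqrt (real CARD('d)) * hu n)))
          (\<lambda>x. hist_density r (empirical_measure n X) (hist_transform \<theta>) x - f x)
        \<le> ennreal (C * (ln (real n) / real n) powr (\<alpha> / (2 * \<alpha> + real CARD('d))))}
      \<ge> 1 - 1 / real n"
proof -
  let ?d = "CARD('d)"
  obtain c where c: "0 < c"
    and holder: "\<And>x x'. x \<in> cube r \<Longrightarrow> x' \<in> cube r \<Longrightarrow> \<bar>f x - f x'\<bar> \<le> c * norm (x - x') powr \<alpha>"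
    using assms(9) unfolding holder_on_def by blast
  obtain \<epsilon> where \<epsilon>: "0 < \<epsilon>" "\<And>n. n \<in> N \<Longrightarrow> \<epsilon> \<le> c0 n"
    using assms(16) by blast
  define B where "B = f 0 + c * (sqrt (real ?d) * r) powr \<alpha>"
  define K where "K = measure lborel (cube r :: (real ^ 'd) set)"
  define \<kappa> where "\<kappa> = unit_ball_vol (real ?d) / 2 ^ ?d"
  \<comment> \<open>Twice the bound on the number of bins is \<open>a / h\<^sup>d\<close>, where the second factor \<open>2\<close> accounts for the
    two tails.\<close>
  define a where "a = 2 * K / \<kappa>"
  \<comment> \<open>\<open>\<kappa> (C1 - B)\<close> is the multiple of \<open>ln n\<close> in the exponent of the deviation bound.\<close>
  define C1 where "C1 = B + (2 + 4 * a) / \<kappa>"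
  define C where "C = C1 + c * (sqrt (real ?d) / \<epsilon>) powr \<alpha>"
  have f_le_B: "f x \<le> B" if "x \<in> cube r" for x
    unfolding B_def using holder c assms(7) that by (rule holder_on_cube_bounded)
  have \<kappa>: "0 < \<kappa>" by (simp add: \<kappa>_def)
  have a: "0 \<le> a" using \<kappa> by (simp add: a_def K_def)
  have B: "0 \<le> B" using assms(3)[of 0] c by (simp add: B_def)
  have C1: "B < C1" using \<kappa> a by (simp add: C1_def add_pos_nonneg)
  have C: "0 < C" unfolding C_def using B C1 c by (intro add_pos_nonneg) auto
  show ?thesis
  proof (intro exI[of _ C] conjI ballI C)
    fix n assume nN: "n \<in> N"
    \<comment> \<open>For \<open>n = 1\<close> the bin width vanishes, so \<open>1\<close> is not among the indices considered.\<close>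
    have "hl 1 = 0" by (simp add: assms(12))
    then have n: "2 \<le> n" using nN unfolding assms(13) by (cases "n = 1") auto
    then have n1: "1 \<le> n" by simp
    note rate = rate_identities[OF n assms(7) assms(12)]
    have h: "0 < hl n" "hl n \<le> hu n" "0 < hu n"
      using rate(2) assms(14)[OF nN] by auto
    define q where "q = (ln (real n) / real n) powr (\<alpha> / (2 * \<alpha> + real ?d))"
    have hq: "hl n powr \<alpha> = q" unfolding q_def by (rule rate(1))
    have q: "0 \<le> q" "q \<le> 1"
      using rate(2,3) assms(7) powr_mono2[of \<alpha> "hl n" 1] by (auto simp flip: hq)
    have bias: "c * (sqrt (real ?d) * hu n) powr \<alpha> \<le> c * (sqrt (real ?d) / \<epsilon>) powr \<alpha> * q"
    proof -
      have "\<epsilon> * hu n \<le> c0 n * hu n"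
        using \<epsilon>(2)[OF nN] h by (intro mult_right_mono) auto
      also have "\<dots> \<le> hl n" using assms(17)[OF nN] by simp
      finally have "hu n \<le> hl n / \<epsilon>"
        using \<epsilon>(1) by (simp add: pos_le_divide_eq mult.commute)
      then have "(sqrt (real ?d) * hu n) powr \<alpha> \<le> (sqrt (real ?d) / \<epsilon> * hl n) powr \<alpha>"
        using h assms(7) mult_left_mono[of "hu n" "hl n / \<epsilon>" "sqrt (real ?d)"] by (intro powr_mono2) auto
      also have "\<dots> = (sqrt (real ?d) / \<epsilon>) powr \<alpha> * q"
        using h \<epsilon>(1) by (subst powr_mult) (auto simp: hq)
      finally show ?thesis using c by (simp add: mult.assoc)
    qed
    have Cq: "C1 * q + c * (sqrt (real ?d) * hu n) powr \<alpha> \<le> C * q"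
      using bias by (simp add: C_def distrib_right)
    define v where "v = unit_ball_vol (real ?d) * (hl n / 2) ^ ?d"
    have v: "v = \<kappa> * hl n ^ ?d" by (simp add: v_def \<kappa>_def power_divide)
    have small: "2 * K / v * exp (- (real n * v * (q * (C1 * q - B * q)))) \<le> 1 / real n"
    proof -
      have "real n * v * (q * (C1 * q - B * q)) = \<kappa> * (C1 - B) * (real n * hl n ^ ?d * (q * q))"
        by (simp add: v algebra_simps)
      also have "\<dots> = (2 + 4 * a) * ln (real n)"
        using rate(4) \<kappa> by (simp add: hq C1_def)
      finally have "a / hl n ^ ?d * exp (- (real n * v * (q * (C1 * q - B * q)))) \<le> 1 / real n"
        using rate(2,5) by (intro failure_probability_le n a) auto
      moreover have "2 * K / v = a / hl n ^ ?d"
        by (simp add: a_def v)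
      ultimately show ?thesis by simp
    qed
    let ?M = "\<Pi>\<^sub>M i\<in>{..<n}. P" and ?\<Theta> = "hist_transform_law \<rho> (hl n) (hu n) :: 'd ht_params measure"
    let ?L = "\<lambda>X \<theta>. Linf_norm (restrict_space lborel (inner_cube r (sqrt (real ?d) * hu n)))
          (\<lambda>x. hist_density r (empirical_measure n X) (hist_transform \<theta>) x - f x)"
    let ?E = "{(X, \<theta>) \<in> space (?M \<Otimes>\<^sub>M ?\<Theta>). ?L X \<theta> \<le> ennreal (C * q)}"
    have sets_P: "sets P = sets borel" by (simp add: assms(4))
    have sets_\<Theta>: "sets ?\<Theta> = sets ht_params_borel"
      using assms(11) by (intro sets_hist_transform_law) (simp add: uniform_rotation_def)
    have M: "prob_space ?M" by (intro prob_space_PiM assms(1))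
    have \<Theta>: "prob_space ?\<Theta>"
      using assms(11) h by (intro prob_space_hist_transform_law) (auto simp: uniform_rotation_def)
    have Cq0: "0 \<le> C * q" using C q by simp
    have E: "?E \<in> sets (?M \<Otimes>\<^sub>M ?\<Theta>)"
      using n Cq0 by (intro sets_Linf_error_event sets_P sets_\<Theta> assms(2)) auto
    have "1 - 1 / real n \<le> measure (?M \<Otimes>\<^sub>M ?\<Theta>) ?E"
    proof (rule prob_pair_ge_of_AE_slice[OF M \<Theta> E])
      show "AE \<theta> in ?\<Theta>. 1 - 1 / real n \<le> measure ?M ((\<lambda>X. (X, \<theta>)) -` ?E)"
        using AE_hist_transform_law[OF assms(11) h(1,2)] AE_space
      proof eventually_elim
        case (elim \<theta>)
        then have \<theta>: "rotation_matrix (fst \<theta>)" "\<And>i. 1 / hu n \<le> fst (snd \<theta>) i" "\<And>i. fst (snd \<theta>) i \<le> 1 / hl n"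
          by auto
        have Bq: "B * q \<le> C1 * q" using C1 q by (intro mult_right_mono) auto
        obtain G where G: "G \<in> sets ?M" "1 - 2 * K / v * exp (- (real n * v * (q * (C1 * q - B * q)))) \<le> measure ?M G"
          and err: "\<And>X x. X \<in> G \<Longrightarrow> x \<in> inner_cube r (sqrt (real ?d) * hu n) \<Longrightarrow>
            \<bar>hist_density r (empirical_measure n X) (hist_transform \<theta>) x - f x\<bar>
              \<le> C1 * q + c * (sqrt (real ?d) * hu n) powr \<alpha>"
          by (rule hist_density_error_fixed_transform[where r = r, OF assms(1,4,2,3) _ c assms(7) _
              \<theta> h(1,3) v_def n1 q Bq, folded K_def]) (erule (1) holder, erule f_le_B, rule that)
        have slice: "(\<lambda>X. (X, \<theta>)) -` ?E \<in> sets ?M"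
          by (rule sets_Pair2[OF E])
        have "G \<subseteq> (\<lambda>X. (X, \<theta>)) -` ?E"
        proof
          fix X assume X: "X \<in> G"
          then have Xs: "X \<in> space ?M" using sets.sets_into_space[OF G(1)] by blast
          have "?L X \<theta> \<le> ennreal (C * q)"
          proof (subst Linf_norm_le_iff[OF _ Cq0])
            have "X \<in> space (\<Pi>\<^sub>M i\<in>{..<n}. borel)"
              using Xs by (simp add: space_PiM assms(4))
            then show "(\<lambda>x. hist_density r (empirical_measure n X) (hist_transform \<theta>) x - f x)
                \<in> borel_measurable (restrict_space lborel (inner_cube r (sqrt (real ?d) * hu n)))"
              using borel_measurable_hist_density_slice[OF n1, of X r \<theta>] assms(2)
              by (intro measurable_restrict_space1 borel_measurable_diff) auto
            show "AE x in restrict_space lborel (inner_cube r (sqrt (real ?d) * hu n)).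
                \<bar>hist_density r (empirical_measure n X) (hist_transform \<theta>) x - f x\<bar> \<le> C * q"
            proof (rule AE_I2)
              fix x :: "real ^ 'd"
              assume "x \<in> space (restrict_space lborel (inner_cube r (sqrt (real ?d) * hu n)))"
              then have "x \<in> inner_cube r (sqrt (real ?d) * hu n)"
                by (simp add: space_restrict_space)
              from err[OF X this] Cq
              show "\<bar>hist_density r (empirical_measure n X) (hist_transform \<theta>) x - f x\<bar> \<le> C * q"
                by (rule order.trans)
            qed
          qed
          then show "X \<in> (\<lambda>X. (X, \<theta>)) -` ?E"
            using Xs elim(2) unfolding space_pair_measure by simp
        qed
        then have "measure ?M G \<le> measure ?M ((\<lambda>X. (X, \<theta>)) -` ?E)"
          by (rule finite_measure.finite_measure_mono[OF prob_space.finite_measure[OF M] _ slice])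
        then show ?case using G(2) small by linarith
      qed
    qed
    then show "let \<nu> = ?M \<Otimes>\<^sub>M ?\<Theta> in
        measure \<nu> {(X, \<theta>) \<in> space \<nu>. ?L X \<theta> \<le> ennreal (C * (ln (real n) / real n) powr (\<alpha> / (2 * \<alpha> + real ?d)))}
        \<ge> 1 - 1 / real n"
      unfolding Let_def q_def .
  qed
qed

end
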